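(* Let $X\sim E_{1}(\mu,\sigma^{2},g_{1})$ be an elliptical random variable with density generator $g_{1}$, scale parameter $\sigma>0$ and finite expectation $\mu$, and let $p,q\in(0,1)$ with $p<q$. Then $$\mathrm{RVaR}_{(p,q)}(X)=\mu+\sigma\,\frac{\delta_{p,q}}{F_{Y}(\eta_{p},\eta_{q})},$$ where $$\delta_{p,q}=c_{1}\left[\overline{G}_{1}\left(\tfrac12\eta_{p}^{2}\right)-\overline{G}_{1}\left(\tfrac12\eta_{q}^{2}\right)\right],$$ $\eta_{v}=(\mathrm{VaR}_{v}(X)-\mu)/\sigma$ for $v\in\{p,q\}$, and $Y\sim E_{1}(0,1,g_{1})$.
   Context: $\mathrm{VaR}_{p}(X)=\inf\{x: P(X\le x)\ge p\}$ is the Value-at-Risk ($p$-quantile). For a random variable $X$ and $0<p<q<1$, $\mathrm{RVaR}_{(p,q)}(X)=\mathrm{E}[X\mid \mathrm{VaR}_{p}(X)\le X\le \mathrm{VaR}_{q}(X)]$. $X\sim E_{1}(\mu,\sigma^{2},g_{1})$ means that $X$ has density $f_X(x)=\frac{c_{1}}{\sigma}g_{1}\left(\frac12\left(\frac{x-\mu}{\sigma}\right)^{2}\right)$, $x\in\mathbb{R}$, where the density generator $g_1\ge 0$ on $[0,\infty)$ satisfies $\int_0^\infty s^{-1/2}g_1(s)\,ds<\infty$, and $c_{1}=\frac{\Gamma(1/2)}{(2\pi)^{1/2}}\left[\int_{0}^{\infty}s^{-1/2}g_{1}(s)\,ds\right]^{-1}$. The cumulative generator is $\overline{G}_{1}(u)=\int_{u}^{\infty}g_{1}(v)\,dv$.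 For a random variable $Z$ with density $f_Z$, $F_{Z}(a,b)=\int_{a}^{b}f_{Z}(z)\,dz$. *)

theory Defs
  imports "HOL-Probability.Probability"
begin

definition VaR :: "'a measure \<Rightarrow> real \<Rightarrow> ('a \<Rightarrow> real) \<Rightarrow> real" where
  "VaR M p X = Inf {x. measure M {\<omega> \<in> space M. X \<omega> \<le> x} \<ge> p}"

text \<open>The conditional expectation given an event \<open>A\<close> of positive probability is the expectation
  under the conditional probability measure \<open>B \<mapsto> P (A \<inter> B) / P A\<close>, i.e. \<open>uniform_measure M A\<close>.\<close>

definition RVaR :: "'a measure \<Rightarrow> real \<Rightarrow> real \<Rightarrow> ('a \<Rightarrow> real) \<Rightarrow> real" where
  "RVaR M p q X =
     (LINT \<omega>|uniform_measure M {\<omega> \<in> space M. VaR M p X \<le> X \<omega> \<and> X \<omega> \<le> VaR M q X}. X \<omega>)"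

text \<open>Measurability of the generator on the half-line is part of the integrability condition.\<close>

definition density_generator :: "(real \<Rightarrow> real) \<Rightarrow> bool" where
  "density_generator g \<longleftrightarrow>
     (\<forall>u\<ge>0. g u \<ge> 0) \<and> set_integrable lborel {0<..} (\<lambda>s. s powr (-1/2) * g s)"

definition norm_const :: "(real \<Rightarrow> real) \<Rightarrow> real" where
  "norm_const g =
     Gamma (1/2) / (2 * pi) powr (1/2) * inverse (LINT s:{0<..}|lborel. s powr (-1/2) * g s)"

definition cumulative_generator :: "(real \<Rightarrow> real) \<Rightarrow> real \<Rightarrow> real" where
  "cumulative_generator g u = (LINT v:{u..}|lborel. g v)"

definition elliptical_density :: "real \<Rightarrow> real \<Rightarrow> (real \<Rightarrow> real) \<Rightarrow> real \<Rightarrow> real" where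
  "elliptical_density \<mu> \<sigma> g x = norm_const g / \<sigma> * g (1/2 * ((x - \<mu>) / \<sigma>)\<^sup>2)"

text \<open>\<open>X \<sim> E\<^sub>1(\<mu>, \<sigma>\<^sup>2, g)\<close>; the argument is the scale \<open>\<sigma>\<close>, not its square.\<close>

definition elliptical ::
  "'a measure \<Rightarrow> ('a \<Rightarrow> real) \<Rightarrow> real \<Rightarrow> real \<Rightarrow> (real \<Rightarrow> real) \<Rightarrow> bool" where
  "elliptical M X \<mu> \<sigma> g \<longleftrightarrow>
     density_generator g \<and> \<sigma> > 0 \<and>
     distributed M lborel X (\<lambda>x. ennreal (elliptical_density \<mu> \<sigma> g x))"

text \<open>The Lebesgue density of \<open>Z\<close>, as a Radon-Nikodym derivative of its law (determined up to null
  sets).\<close>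

definition rv_density :: "'a measure \<Rightarrow> ('a \<Rightarrow> real) \<Rightarrow> real \<Rightarrow> real" where
  "rv_density M Z z = enn2real (RN_deriv lborel (distr M lborel Z) z)"

definition F_int :: "'a measure \<Rightarrow> ('a \<Rightarrow> real) \<Rightarrow> real \<Rightarrow> real \<Rightarrow> real" where
  "F_int M Z a b = (LBINT z=ereal a..ereal b. rv_density M Z z)"

end

theory Submission
  imports Defs
begin

text \<open>
  Write \<open>Z = (X - \<mu>) / \<sigma>\<close>. Then \<open>Z\<close> has the standard elliptical density
  \<open>f z = c\<^sub>1 * g\<^sub>1 (z\<^sup>2 / 2)\<close>, the same as \<open>Y\<close>, and the event
  \<open>VaR\<^sub>p X \<le> X \<le> VaR\<^sub>q X\<close> is \<open>\<eta>\<^sub>p \<le> Z \<le> \<eta>\<^sub>q\<close>. Its probability is \<open>F\<^sub>Y(\<eta>\<^sub>p, \<eta>\<^sub>q)\<close>, so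

    \<open>RVaR X = \<mu> + \<sigma> * (\<integral> z * f z over [\<eta>\<^sub>p, \<eta>\<^sub>q]) / F\<^sub>Y(\<eta>\<^sub>p, \<eta>\<^sub>q)\<close>.

  The integrand \<open>z * g\<^sub>1 (z\<^sup>2 / 2)\<close> is the derivative of \<open>-G (z\<^sup>2 / 2)\<close>, where \<open>G\<close> is the
  cumulative generator. As \<open>g\<^sub>1\<close> is merely measurable, this is made precise by the substitution
  \<open>v = z\<^sup>2 / 2\<close> on a tail \<open>[a, \<infinity>)\<close>, which is injective only for \<open>a \<ge> 0\<close>
  (\<open>integral_Ici_eq_cumulative_generator\<close>). For \<open>a < 0\<close> the integrand being odd makes
  the tail integrals from \<open>a\<close> and \<open>-a\<close> agree (\<open>set_integral_Ici_odd\<close>), so the tail integral is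
  \<open>G (a\<^sup>2 / 2)\<close> whatever the sign of \<open>a\<close>, and the integral over an interval is a difference of
  two tails.

  The finite expectation of \<open>X\<close> is what makes \<open>z * g\<^sub>1 (z\<^sup>2 / 2)\<close> integrable over the whole line,
  and hence \<open>g\<^sub>1\<close> integrable over every \<open>[u, \<infinity>)\<close> with \<open>u \<ge> 0\<close>. The conditioning event has
  positive probability because the interval between the \<open>p\<close>- and the \<open>q\<close>-quantile carries
  mass at least \<open>q - p\<close> (\<open>prob_between_VaR_ge\<close>).
\<close>

section \<open>Mass between two quantiles, and conditional expectation\<close>

text \<open>The distribution function is below \<open>p\<close> to the left of the \<open>p\<close>-quantile, so the mass strictly
  to the left of it is at most \<open>p\<close>; by right-continuity the distribution function is at least \<open>q\<close>
  at the \<open>q\<close>-quantile. Atoms are allowed, which is why only an inequality holds.\<close>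

lemma (in prob_space) prob_between_VaR_ge:
  assumes X [measurable]: "random_variable borel X" and p: "0 < p" and q: "q < 1"
  shows "q - p \<le> prob {\<omega> \<in> space M. VaR M p X \<le> X \<omega> \<and> X \<omega> \<le> VaR M q X}"
proof -
  define D where "D = distr M borel X"
  interpret D: real_distribution D
    unfolding D_def by (rule real_distribution_distr) (rule X)
  have VaR_eq: "VaR M v X = Inf {x. v \<le> cdf D x}" for v
    by (simp add: VaR_def D_def cdf_def measure_distr vimage_def Int_def conj_commute)
  \<comment> \<open>The infimum in the definition of \<open>VaR\<close> is meaningful only for sets that are nonempty and
    bounded below; this is where \<open>0 < p\<close> and \<open>q < 1\<close> enter.\<close>
  have bdd: "bdd_below {x. v \<le> cdf D x}" if v: "0 < v" for v
  proof -
    have "eventually (\<lambda>x. cdf D x < v) at_bot"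
      using D.cdf_lim_at_bot v by (rule order_tendstoD)
    then obtain B where B: "\<And>x. x \<le> B \<Longrightarrow> cdf D x < v"
      by (auto simp: eventually_at_bot_linorder)
    show ?thesis
    proof (rule bdd_belowI)
      show "B \<le> x" if "x \<in> {x. v \<le> cdf D x}" for x
        using that B[of x] by (cases "x \<le> B") auto
    qed
  qed
  have nonempty: "{x. v \<le> cdf D x} \<noteq> {}" if v: "v < 1" for v
  proof -
    have "eventually (\<lambda>x. v < cdf D x) at_top"
      using D.cdf_lim_at_top_prob v by (rule order_tendstoD)
    then show ?thesis
      by (auto simp: eventually_at_top_linorder dest: less_imp_le)
  qed
  have below: "measure D {..<VaR M p X} \<le> p"
  proof (rule tendsto_upperbound[OF D.cdf_at_left])
    have "cdf D x \<le> p" if "x < VaR M p X" for x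
      using that cInf_lower[OF _ bdd[OF p], of x] unfolding VaR_eq by force
    then show "eventually (\<lambda>x. cdf D x \<le> p) (at_left (VaR M p X))"
      by (auto simp: eventually_at_filter)
  qed simp
  have upto: "q \<le> cdf D (VaR M q X)"
  proof (rule tendsto_lowerbound)
    show "(cdf D \<longlongrightarrow> cdf D (VaR M q X)) (at_right (VaR M q X))"
      using D.cdf_is_right_cont by (simp add: continuous_within)
    have "q \<le> cdf D x" if x: "VaR M q X < x" for x
    proof -
      obtain y where "q \<le> cdf D y" "y < x"
        using x cInf_lessD[OF nonempty[OF q]] unfolding VaR_eq by blast
      then show ?thesis
        using D.cdf_nondecreasing[of y x] by simp
    qed
    then show "eventually (\<lambda>x. q \<le> cdf D x) (at_right (VaR M q X))"
      by (auto simp: eventually_at_filter)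
  qed simp
  have "cdf D (VaR M q X) \<le> measure D ({..<VaR M p X} \<union> {VaR M p X..VaR M q X})"
    unfolding cdf_def by (rule D.finite_measure_mono) auto
  also have "\<dots> \<le> measure D {..<VaR M p X} + measure D {VaR M p X..VaR M q X}"
    by (rule measure_Un_le) auto
  finally have "q - p \<le> measure D {VaR M p X..VaR M q X}"
    using below upto by simp
  also have "\<dots> = prob {\<omega> \<in> space M. VaR M p X \<le> X \<omega> \<and> X \<omega> \<le> VaR M q X}"
    by (simp add: D_def measure_distr vimage_def Int_def conj_commute)
  finally show ?thesis .
qed

lemma (in prob_space) integral_uniform_measure_eq:
  fixes X :: "'a \<Rightarrow> real"
  assumes A [measurable]: "A \<in> events" and [measurable]: "random_variable borel X" and "prob A \<noteq> 0"
  shows "(LINT \<omega>|uniform_measure M A. X \<omega>) = (LINT \<omega>:A|M. X \<omega>) / prob A"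
proof -
  have "uniform_measure M A = density M (\<lambda>\<omega>. ennreal (indicator A \<omega> / prob A))"
    unfolding uniform_measure_def emeasure_eq_measure
    using assms(3) by (intro density_cong)
      (auto simp: divide_ennreal indicator_def measure_nonneg less_le ennreal_1[symmetric] simp del: ennreal_1)
  then show ?thesis
    using assms(3) by (simp add: integral_density set_lebesgue_integral_def)
qed

section \<open>Integrals of \<open>z * g (z\<^sup>2 / 2)\<close> and the cumulative generator\<close>

text \<open>Reflection turns the integral over \<open>[-a, \<infinity>)\<close> into minus the integral over \<open>(-\<infinity>, a]\<close>, and the
  total integral vanishes; so the two tails agree for either sign of \<open>a\<close>.\<close>

lemma set_integral_Ici_odd:
  fixes h :: "real \<Rightarrow> real"
  assumes h: "integrable lborel h" and odd: "\<And>x. h (- x) = - h x"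
  shows "(LINT x:{-a..}|lborel. h x) = (LINT x:{a..}|lborel. h x)"
proof -
  have seti: "set_integrable lborel A h" if "A \<in> sets borel" for A
    unfolding set_integrable_def using integrable_mult_indicator[OF _ h] that by simp
  have total: "(LINT x|lborel. h x) = 0"
    using lborel_integral_real_affine[of "-1" h 0] by (simp add: odd)
  \<comment> \<open>The two sides are related by the substitution of \<open>-x\<close> for \<open>x\<close>.\<close>
  have "(LINT x:{-a..}|lborel. h x) = - (LINT x:{..a}|lborel. h x)"
    unfolding set_lebesgue_integral_def
    by (subst lborel_integral_real_affine[of "-1" _ 0])
      (auto simp: odd indicator_def simp flip: integral_minus intro!: Bochner_Integration.integral_cong)
  also have "\<dots> = (LINT x:{a<..}|lborel. h x)"
  proof -
    have "(LINT x|lborel. h x) = (LINT x:{..a} \<union> {a<..}|lborel. h x)"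
      by (auto simp: set_lebesgue_integral_def indicator_def intro!: Bochner_Integration.integral_cong)
    also have "\<dots> = (LINT x:{..a}|lborel. h x) + (LINT x:{a<..}|lborel. h x)"
      by (rule set_integral_Un) (auto intro: seti)
    finally show ?thesis using total by simp
  qed
  also have "\<dots> = (LINT x:{a..}|lborel. h x)"
    unfolding set_lebesgue_integral_def
  proof (rule integral_cong_AE)
    show "AE x in lborel. indicat_real {a<..} x *\<^sub>R h x = indicat_real {a..} x *\<^sub>R h x"
      using AE_lborel_singleton[of a] by eventually_elim (auto simp: indicator_def)
  qed (use seti[of "{a<..}"] seti[of "{a..}"] in \<open>auto simp: set_integrable_def\<close>)
  finally show ?thesis .
qed

text \<open>Measurability of \<open>g\<close> itself is only implicit in the integrability of \<open>s powr (-1/2) * g s\<close> on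
  the open half-line: the weight has to be divided out, and the value at \<open>0\<close> restored.\<close>

lemma density_generator_borel_measurable_Ici:
  assumes "density_generator g" and "0 \<le> u"
  shows "set_borel_measurable lborel {u..} g"
proof -
  let ?w = "\<lambda>s. indicator {0<..} s *\<^sub>R (s powr (-1/2) * g s)"
  have "integrable lborel ?w"
    using assms(1) unfolding density_generator_def set_integrable_def by blast
  then have [measurable]: "?w \<in> borel_measurable borel"
    using borel_measurable_integrable[of lborel ?w] by simp
  have "(\<lambda>s. indicator {u..} s * (?w s * s powr (1/2) + indicator {0} s * g 0)) \<in> borel_measurable borel"
    by measurable
  also have "(\<lambda>s. indicator {u..} s * (?w s * s powr (1/2) + indicator {0} s * g 0)) =
      (\<lambda>s. indicator {u..} s *\<^sub>R g s)"
  proof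
    fix s :: real
    have "s powr (-1/2) * g s * s powr (1/2) = g s" if "0 < s"
      using that powr_add[of s "-1/2" "1/2"] by (simp add: mult_ac)
    then show "indicator {u..} s * (?w s * s powr (1/2) + indicator {0} s * g 0) = indicator {u..} s *\<^sub>R g s"
      using assms(2) by (cases "0 < s"; cases "s = 0") (auto simp: indicator_def)
  qed
  finally show ?thesis
    by (simp add: set_borel_measurable_def)
qed

text \<open>This is the substitution \<open>v = z\<^sup>2 / 2\<close>, \<open>dv = z dz\<close>. The change-of-variables theorem for the
  Lebesgue measure carries integrability over from \<open>z * g (z\<^sup>2 / 2)\<close> to \<open>g\<close>; Borel measurability
  of \<open>g\<close> then brings the result back to \<open>lborel\<close>.\<close>

lemma integral_Ici_eq_cumulative_generator:
  assumes g: "density_generator g" and "0 \<le> a"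
    and int: "set_integrable lborel {a..} (\<lambda>z. z * g (1/2 * z\<^sup>2))"
  shows "(LINT z:{a..}|lborel. z * g (1/2 * z\<^sup>2)) = cumulative_generator g (1/2 * a\<^sup>2)"
proof -
  let ?h = "\<lambda>z. z * g (1/2 * z\<^sup>2)" and ?s = "\<lambda>z::real. 1/2 * z\<^sup>2"
  have abs_eq: "\<bar>z\<bar> * g (?s z) = ?h z" if "z \<in> {a..}" for z
    using that \<open>0 \<le> a\<close> by simp
  have image: "?s ` {a..} = {?s a..}"
  proof (intro equalityI subsetI)
    fix v assume "v \<in> {?s a..}"
    then have v: "a\<^sup>2 \<le> 2 * v" by simp
    then have "0 \<le> v"
      using zero_le_power2[of a] by linarith
    with v have "a \<le> sqrt (2 * v)" "v = ?s (sqrt (2 * v))"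
      by (auto intro: real_le_rsqrt)
    then show "v \<in> ?s ` {a..}" by blast
  qed (use \<open>0 \<le> a\<close> in \<open>auto intro: power_mono\<close>)
  have inj: "inj_on ?s {a..}"
    using \<open>0 \<le> a\<close> by (auto intro!: inj_onI simp: power2_eq_iff)
  have lebesgue: "?h absolutely_integrable_on {a..}"
    using int unfolding set_integrable_def by (subst integrable_completion) auto
  have "?h absolutely_integrable_on {a..} \<longleftrightarrow> (\<lambda>z. \<bar>z\<bar> * g (?s z)) absolutely_integrable_on {a..}"
    by (rule set_integrable_cong) (use \<open>0 \<le> a\<close> in auto)
  moreover have "(?s has_field_derivative z) (at z within {a..})" for z
    by (auto intro!: derivative_eq_intros)
  ultimately have "g absolutely_integrable_on {?s a..} \<and>
      integral {?s a..} g = integral {a..} (\<lambda>z. \<bar>z\<bar> * g (?s z))"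
    using has_absolute_integral_change_of_variables_1'[OF _ _ inj, of "\<lambda>z. z" g
        "integral {a..} (\<lambda>z. \<bar>z\<bar> * g (?s z))"] lebesgue
    unfolding image by simp
  then have g_int: "g absolutely_integrable_on {?s a..}" and eq: "integral {?s a..} g = integral {a..} ?h"
    using integral_cong[of "{a..}", OF abs_eq] by (simp_all only:)
  have "(LINT z:{a..}|lborel. ?h z) = integral {a..} ?h"
    using set_lebesgue_integral_eq_integral(2)[OF lebesgue] int
    unfolding set_lebesgue_integral_def set_integrable_def
    by (subst (asm) integral_completion) auto
  also have "\<dots> = integral {?s a..} g"
    by (rule eq[symmetric])
  also have "\<dots> = cumulative_generator g (?s a)"
    using set_lebesgue_integral_eq_integral(2)[OF g_int] density_generator_borel_measurable_Ici[OF g, of "?s a"]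
    unfolding set_lebesgue_integral_def set_borel_measurable_def cumulative_generator_def
    by (subst (asm) integral_completion) auto
  finally show ?thesis .
qed

text \<open>The function \<open>z \<mapsto> -G (z\<^sup>2 / 2)\<close> is a primitive of the integrand, in integrated form. Integrability
  on the whole line serves the oddness argument for a tail that starts at a negative number.\<close>

lemma set_integral_Icc_eq_cumulative_generator_diff:
  assumes g: "density_generator g" and int: "integrable lborel (\<lambda>z. z * g (1/2 * z\<^sup>2))" and "a \<le> b"
  shows "(LINT z:{a..b}|lborel. z * g (1/2 * z\<^sup>2)) =
    cumulative_generator g (1/2 * a\<^sup>2) - cumulative_generator g (1/2 * b\<^sup>2)"
proof -
  let ?h = "\<lambda>z. z * g (1/2 * z\<^sup>2)"
  have seti: "set_integrable lborel A ?h" if "A \<in> sets borel" for A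
    unfolding set_integrable_def using integrable_mult_indicator[OF _ int] that by simp
  have tail: "(LINT z:{c..}|lborel. ?h z) = cumulative_generator g (1/2 * c\<^sup>2)" for c
  proof (cases "0 \<le> c")
    case True
    then show ?thesis
      by (intro integral_Ici_eq_cumulative_generator g seti) auto
  next
    case False
    have "(LINT z:{c..}|lborel. ?h z) = (LINT z:{-c..}|lborel. ?h z)"
      using set_integral_Ici_odd[OF int, of "-c"] by simp
    also have "\<dots> = cumulative_generator g (1/2 * c\<^sup>2)"
      using integral_Ici_eq_cumulative_generator[OF g, of "-c"] seti False by simp
    finally show ?thesis .
  qed
  have "(LINT z:{a..}|lborel. ?h z) = (LINT z:{a..b} \<union> {b<..}|lborel. ?h z)"
    using \<open>a \<le> b\<close> by (intro arg_cong[where f="\<lambda>A. set_lebesgue_integral lborel A ?h"]) auto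
  also have "\<dots> = (LINT z:{a..b}|lborel. ?h z) + (LINT z:{b<..}|lborel. ?h z)"
    by (rule set_integral_Un) (auto simp del: times_divide_eq_left intro!: seti)
  also have "(LINT z:{b<..}|lborel. ?h z) = (LINT z:{b..}|lborel. ?h z)"
    unfolding set_lebesgue_integral_def
  proof (rule integral_cong_AE)
    show "AE z in lborel. indicat_real {b<..} z *\<^sub>R ?h z = indicat_real {b..} z *\<^sub>R ?h z"
      using AE_lborel_singleton[of b] by eventually_elim (auto simp: indicator_def)
  qed (use seti[of "{b<..}"] seti[of "{b..}"] in \<open>auto simp: set_integrable_def\<close>)
  finally show ?thesis
    unfolding tail by simp
qed

section \<open>Elliptical densities\<close>

lemma norm_const_nonneg:
  assumes "density_generator g"
  shows "0 \<le> norm_const g"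
  using assms unfolding norm_const_def density_generator_def set_lebesgue_integral_def
  by (auto intro!: mult_nonneg_nonneg divide_nonneg_nonneg integral_nonneg simp: indicator_def)

lemma elliptical_density_nonneg:
  assumes "density_generator g" "0 < \<sigma>"
  shows "0 \<le> elliptical_density \<mu> \<sigma> g x"
  using assms norm_const_nonneg[OF assms(1)] 
  unfolding elliptical_density_def density_generator_def
  by (auto intro!: mult_nonneg_nonneg divide_nonneg_nonneg)

text \<open>Densities are unique up to null sets, so the Radon-Nikodym derivative in \<open>F_int\<close> may be replaced
  by any given density.\<close>

lemma F_int_eq_integral_density:
  assumes "distributed N lborel Y (\<lambda>y. ennreal (f y))" and nonneg: "\<And>y. 0 \<le> f y" and "a \<le> b"
  shows "F_int N Y a b = (LINT y:{a..b}|lborel. f y)"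
proof -
  have [measurable]: "f \<in> borel_measurable borel"
    using distributed_real_measurable[of lborel f N Y] assms by simp
  have "AE y in lborel. ennreal (f y) = RN_deriv lborel (distr N lborel Y) y"
    using assms(1) by (intro sigma_finite_measure.RN_deriv_unique sigma_finite_lborel)
      (auto simp: distributed_def)
  then have ae: "AE y in lborel. rv_density N Y y = f y"
    by eventually_elim (metis rv_density_def enn2real_ennreal nonneg)
  have [measurable]: "rv_density N Y \<in> borel_measurable borel"
    using borel_measurable_RN_deriv[of lborel "distr N lborel Y"]
    unfolding rv_density_def[abs_def] by simp
  have "F_int N Y a b = (LINT y:{a..b}|lborel. rv_density N Y y)"
    unfolding F_int_def using \<open>a \<le> b\<close> by (rule interval_integral_Icc)
  also have "\<dots> = (LINT y:{a..b}|lborel. f y)"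
    unfolding set_lebesgue_integral_def
    by (rule integral_cong_AE) (use ae in auto)
  finally show ?thesis .
qed

lemma (in prob_space) elliptical_standardize:
  assumes "elliptical M X \<mu> \<sigma> g"
  shows "elliptical M (\<lambda>\<omega>. (X \<omega> - \<mu>) / \<sigma>) 0 1 g"
proof -
  from assms have g: "density_generator g" and "0 < \<sigma>"
    and X: "distributed M lborel X (\<lambda>x. ennreal (elliptical_density \<mu> \<sigma> g x))"
    by (auto simp: elliptical_def)
  have "distributed M lborel (\<lambda>\<omega>. - \<mu> / \<sigma> + 1 / \<sigma> * X \<omega>)
      (\<lambda>z. ennreal (elliptical_density \<mu> \<sigma> g ((z - (- \<mu> / \<sigma>)) / (1 / \<sigma>))) / \<bar>1 / \<sigma>\<bar>)"
    using \<open>0 < \<sigma>\<close> by (intro distributed_affine X) auto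
  also have "(\<lambda>\<omega>. - \<mu> / \<sigma> + 1 / \<sigma> * X \<omega>) = (\<lambda>\<omega>. (X \<omega> - \<mu>) / \<sigma>)"
    using \<open>0 < \<sigma>\<close> by (auto simp: field_simps)
  also have "(\<lambda>z. ennreal (elliptical_density \<mu> \<sigma> g ((z - (- \<mu> / \<sigma>)) / (1 / \<sigma>))) / \<bar>1 / \<sigma>\<bar>) =
      (\<lambda>z. ennreal (elliptical_density 0 1 g z))"
  proof
    fix z
    have "elliptical_density \<mu> \<sigma> g ((z - (- \<mu> / \<sigma>)) / (1 / \<sigma>)) / \<bar>1 / \<sigma>\<bar> = elliptical_density 0 1 g z"
      using \<open>0 < \<sigma>\<close> by (simp add: elliptical_density_def field_simps)
    then show "ennreal (elliptical_density \<mu> \<sigma> g ((z - (- \<mu> / \<sigma>)) / (1 / \<sigma>))) / \<bar>1 / \<sigma>\<bar> =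
        ennreal (elliptical_density 0 1 g z)"
      using \<open>0 < \<sigma>\<close> elliptical_density_nonneg[OF g \<open>0 < \<sigma>\<close>]
      by (subst divide_ennreal) auto
  qed
  finally show ?thesis
    using g by (simp add: elliptical_def)
qed

text \<open>The density contributes the constant \<open>norm_const g\<close>. It is nonzero because the density has total
  mass one; thus integrability of \<open>Z\<close> passes to \<open>z * g (z\<^sup>2 / 2)\<close>.\<close>

lemma (in prob_space) expectation_elliptical_Icc:
  assumes Z: "elliptical M Z 0 1 g" and int: "integrable M Z" and "a \<le> b"
  shows "(LINT \<omega>:{\<omega> \<in> space M. a \<le> Z \<omega> \<and> Z \<omega> \<le> b}|M. Z \<omega>) =
    norm_const g * (cumulative_generator g (1/2 * a\<^sup>2) - cumulative_generator g (1/2 * b\<^sup>2))"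
proof -
  let ?c = "norm_const g" and ?h = "\<lambda>z. z * g (1/2 * z\<^sup>2)"
  from Z have g: "density_generator g"
    and distr: "distributed M lborel Z (\<lambda>z. ennreal (elliptical_density 0 1 g z))"
    by (auto simp: elliptical_def)
  have nonneg: "0 \<le> elliptical_density 0 1 g z" for z
    by (rule elliptical_density_nonneg[OF g]) simp
  have dens: "elliptical_density 0 1 g z = ?c * g (1/2 * z\<^sup>2)" for z
    by (simp add: elliptical_density_def)
  have c: "?c \<noteq> 0"
  proof
    assume "?c = 0"
    then have "(LINT \<omega>|M. 1) = (0::real)"
      using distributed_integral[OF distr, of "\<lambda>_. 1"] nonneg by (simp add: dens)
    then show False by (simp add: prob_space)
  qed
  have "integrable lborel (\<lambda>z. elliptical_density 0 1 g z * z)"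
    using distributed_integrable[OF distr, of "\<lambda>z. z"] nonneg int by simp
  also have "(\<lambda>z. elliptical_density 0 1 g z * z) = (\<lambda>z. ?c * ?h z)"
    by (auto simp: dens)
  finally have h: "integrable lborel ?h"
    using c by simp
  have "(LINT \<omega>:{\<omega> \<in> space M. a \<le> Z \<omega> \<and> Z \<omega> \<le> b}|M. Z \<omega>) =
      (LINT \<omega>|M. indicator {a..b} (Z \<omega>) * Z \<omega>)"
    unfolding set_lebesgue_integral_def
    by (rule Bochner_Integration.integral_cong) (auto simp: indicator_def)
  also have "\<dots> = (LINT z|lborel. elliptical_density 0 1 g z * (indicator {a..b} z * z))"
    using nonneg by (intro distributed_integral[OF distr, symmetric]) auto
  also have "\<dots> = ?c * (LINT z:{a..b}|lborel. ?h z)"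
    unfolding set_lebesgue_integral_def
    by (subst integral_mult_right_zero[symmetric], rule Bochner_Integration.integral_cong)
      (auto simp: dens)
  also have "(LINT z:{a..b}|lborel. ?h z) =
      cumulative_generator g (1/2 * a\<^sup>2) - cumulative_generator g (1/2 * b\<^sup>2)"
    by (rule set_integral_Icc_eq_cumulative_generator_diff[OF g h \<open>a \<le> b\<close>])
  finally show ?thesis .
qed

section \<open>The Range Value-at-Risk of an elliptical variable\<close>

theorem theorem1:
  fixes M :: "'a measure" and N :: "'b measure"
    and X :: "'a \<Rightarrow> real" and Y :: "'b \<Rightarrow> real"
    and g\<^sub>1 :: "real \<Rightarrow> real" and \<mu> \<sigma> p q :: real
    and \<eta> :: "real \<Rightarrow> real" and \<delta> :: real
  assumes "prob_space M" and "prob_space N"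
    and "\<sigma> > 0"
    and "elliptical M X \<mu> \<sigma> g\<^sub>1"
    and "integrable M X" and "(LINT \<omega>|M. X \<omega>) = \<mu>"
    and "elliptical N Y 0 1 g\<^sub>1"
    and "0 < p" and "p < q" and "q < 1"
    and "\<And>v. v \<in> {p, q} \<Longrightarrow> \<eta> v = (VaR M v X - \<mu>) / \<sigma>"
    and "\<delta> = norm_const g\<^sub>1 *
           (cumulative_generator g\<^sub>1 (1/2 * (\<eta> p)\<^sup>2) - cumulative_generator g\<^sub>1 (1/2 * (\<eta> q)\<^sup>2))"
  shows "RVaR M p q X = \<mu> + \<sigma> * (\<delta> / F_int N Y (\<eta> p) (\<eta> q))"
proof -
  interpret prob_space M by fact
  let ?f = "elliptical_density 0 1 g\<^sub>1"
  define Z where "Z \<omega> = (X \<omega> - \<mu>) / \<sigma>" for \<omega>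
  define A where "A = {\<omega> \<in> space M. VaR M p X \<le> X \<omega> \<and> X \<omega> \<le> VaR M q X}"
  have X_eq: "X \<omega> = \<mu> + \<sigma> * Z \<omega>" for \<omega>
    using \<open>\<sigma> > 0\<close> by (simp add: Z_def)
  have [measurable]: "random_variable borel X"
    using \<open>integrable M X\<close> by (rule borel_measurable_integrable)
  have Z_int: "integrable M Z"
    unfolding Z_def using \<open>integrable M X\<close> by simp
  then have [measurable]: "random_variable borel Z"
    by (rule borel_measurable_integrable)
  have A [measurable]: "A \<in> events"
    unfolding A_def by measurable
  have A_eq: "A = {\<omega> \<in> space M. \<eta> p \<le> Z \<omega> \<and> Z \<omega> \<le> \<eta> q}"
    using \<open>\<sigma> > 0\<close> assms(11) by (auto simp: A_def Z_def divide_le_cancel)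
  \<comment> \<open>Positivity of \<open>prob A\<close> also shows that the event is nonempty, which orders the two quantiles.\<close>
  have "q - p \<le> prob A"
    unfolding A_def by (rule prob_between_VaR_ge) (use assms(8-10) in auto)
  then have A_pos: "0 < prob A"
    using \<open>p < q\<close> by simp
  then have "A \<noteq> {}" by auto
  then have le: "\<eta> p \<le> \<eta> q"
    by (auto simp: A_eq)
  have g: "density_generator g\<^sub>1" and Y: "distributed N lborel Y (\<lambda>y. ennreal (?f y))"
    using \<open>elliptical N Y 0 1 g\<^sub>1\<close> by (auto simp: elliptical_def)
  have nonneg: "0 \<le> ?f z" for z
    by (rule elliptical_density_nonneg[OF g]) simp
  have Z_ell: "elliptical M Z 0 1 g\<^sub>1"
    unfolding Z_def by (rule elliptical_standardize) fact
  then have Z: "distributed M lborel Z (\<lambda>z. ennreal (?f z))"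
    by (simp add: elliptical_def)
  have prob_A: "prob A = F_int N Y (\<eta> p) (\<eta> q)"
  proof -
    have "prob A = (LINT \<omega>|M. indicator A \<omega>)"
      by simp
    also have "\<dots> = (LINT \<omega>|M. indicator {\<eta> p..\<eta> q} (Z \<omega>))"
      by (rule Bochner_Integration.integral_cong) (auto simp: A_eq indicator_def)
    also have "\<dots> = (LINT z|lborel. ?f z * indicator {\<eta> p..\<eta> q} z)"
      using nonneg by (intro distributed_integral[OF Z, symmetric]) auto
    also have "\<dots> = F_int N Y (\<eta> p) (\<eta> q)"
      by (simp add: F_int_eq_integral_density[OF Y nonneg le] set_lebesgue_integral_def mult.commute)
    finally show ?thesis .
  qed
  have Z_A: "set_integrable M A Z"
    unfolding set_integrable_def by (rule integrable_mult_indicator[OF A Z_int])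
  have "RVaR M p q X = (LINT \<omega>:A|M. X \<omega>) / prob A"
    unfolding RVaR_def A_def[symmetric] using A_pos by (intro integral_uniform_measure_eq) auto
  also have "(LINT \<omega>:A|M. X \<omega>) = (LINT \<omega>:A|M. \<mu> + \<sigma> * Z \<omega>)"
    by (simp add: X_eq)
  also have "\<dots> = (LINT \<omega>:A|M. \<mu>) + (LINT \<omega>:A|M. \<sigma> * Z \<omega>)"
  proof (rule set_integral_add(2))
    show "set_integrable M A (\<lambda>_. \<mu>)"
      unfolding set_integrable_def by (rule integrable_mult_indicator) auto
    show "set_integrable M A (\<lambda>\<omega>. \<sigma> * Z \<omega>)"
      using Z_A by (rule set_integrable_mult_right)
  qed
  also have "\<dots> = \<mu> * prob A + \<sigma> * (LINT \<omega>:A|M. Z \<omega>)"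
    by (simp add: set_lebesgue_integral_def mult.left_commute)
  also have "(LINT \<omega>:A|M. Z \<omega>) = \<delta>"
    unfolding A_eq assms(12) by (rule expectation_elliptical_Icc[OF Z_ell Z_int le])
  finally show ?thesis
    using A_pos by (simp add: prob_A[symmetric] field_simps)
qed

end
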